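(* Let $\mathcal{H}$ be a real Hilbert space, let $\beta\in(0,1)$, and let $\varphi:\mathcal{H}\to(-\infty,+\infty]$ be a proper function such that $\check{\varphi}:=\varphi+\frac{1-\beta}{2}\|\cdot\|^2\in\Gamma_0(\mathcal{H})$. Then $$\mathrm{s\text{-}Prox}_{\varphi}=\mathrm{s\text{-}Prox}_{\check{\varphi}/\beta}\circ(\beta^{-1}\mathrm{Id}),$$ $$\mathrm{Id}=\beta\,\mathrm{s\text{-}Prox}_{\varphi}+\mathrm{s\text{-}Prox}_{\beta\check{\varphi}^{*}}.$$
   Context: $\Gamma_0(\mathcal{H})$ is the set of proper lower semicontinuous convex functions $\mathcal{H}\to(-\infty,+\infty]$. $\mathrm{Id}$ is the identity operator on $\mathcal{H}$. For a proper function $f:\mathcal{H}\to(-\infty,+\infty]$ such that $f+\frac12\|x-\cdot\|^2$ has a unique minimizer for every $x\in\mathcal{H}$, the single-valued proximity operator is $\mathrm{s\text{-}Prox}_f(x):=\operatorname{argmin}_{y\in\mathcal{H}}\big(f(y)+\frac12\|x-y\|^2\big)$; for $f\in\Gamma_0(\mathcal{H})$ this is Moreau's classical proximity operator. The Fenchel conjugate is $f^*(x):=\sup_{y\in\mathcal{H}}[\langle x,y\rangle-f(y)]$. *)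

theory Defs
  imports "HOL-Analysis.Analysis"
begin

definition proper_fun :: "('a \<Rightarrow> ereal) \<Rightarrow> bool" where
  "proper_fun f \<longleftrightarrow> (\<forall>x. f x \<noteq> -\<infinity>) \<and> (\<exists>x. f x < \<infinity>)"

(* The library's convex_on is for real-valued functions only. The right-hand side below is
   meant for functions that never take the value -\<infinity>; restricting t to the open unit interval
   avoids the product 0 * \<infinity>. *)
definition ereal_convex :: "('a::real_vector \<Rightarrow> ereal) \<Rightarrow> bool" where
  "ereal_convex f \<longleftrightarrow>
     (\<forall>x y t. 0 < t \<and> t < 1 \<longrightarrow>
        f ((1 - t) *\<^sub>R x + t *\<^sub>R y) \<le> ereal (1 - t) * f x + ereal t * f y)"

definition lower_semicontinuous :: "('a::topological_space \<Rightarrow> ereal) \<Rightarrow> bool" where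
  "lower_semicontinuous f \<longleftrightarrow> (\<forall>x. f x \<le> Liminf (at x) f)"

definition Gamma0 :: "('a::{real_inner,complete_space} \<Rightarrow> ereal) set" where
  "Gamma0 = {f. proper_fun f \<and> lower_semicontinuous f \<and> ereal_convex f}"

definition fenchel_conjugate :: "('a::real_inner \<Rightarrow> ereal) \<Rightarrow> 'a \<Rightarrow> ereal" where
  "fenchel_conjugate f x = (SUP y. ereal (x \<bullet> y) - f y)"

definition prox_objective :: "('a::real_inner \<Rightarrow> ereal) \<Rightarrow> 'a \<Rightarrow> 'a \<Rightarrow> ereal" where
  "prox_objective f x y = f y + ereal (1 / 2 * (norm (x - y))\<^sup>2)"

definition has_s_Prox :: "('a::real_inner \<Rightarrow> ereal) \<Rightarrow> bool" where
  "has_s_Prox f \<longleftrightarrow>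
     proper_fun f \<and> (\<forall>x. \<exists>!y. is_arg_min (prox_objective f x) (\<lambda>_. True) y)"

(* Meaningful only when has_s_Prox f holds; arg_min is a choice operator otherwise. *)
definition s_Prox :: "('a::real_inner \<Rightarrow> ereal) \<Rightarrow> 'a \<Rightarrow> 'a" where
  "s_Prox f x = arg_min (prox_objective f x) (\<lambda>_. True)"

end

theory Submission
  imports Defs
begin

text \<open>All three proximity operators come from one map. For every \<open>x\<close> there is a point \<open>P(x)\<close> with
  \<open>x - \<beta> P(x) \<in> \<partial>\<phi>c(P(x))\<close>, where \<open>\<partial>\<close> is the convex subdifferential: it is the minimizer of the
  strongly convex function \<open>\<phi>c + \<beta> / 2 * \<parallel>\<cdot>\<parallel>\<^sup>2 - \<langle>x, \<cdot>\<rangle>\<close>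
  (\<open>Gamma0_quadratic_minimizer\<close>, \<open>Gamma0_resolvent\<close>). This is where completeness
  of the space and lower semicontinuity enter.

  A subgradient inequality certifies a unique proximal point (\<open>prox_certificate\<close>), and the
  inequality at \<open>P(x)\<close> can be read in three ways.

  \<^item> Subtracting \<open>(1 - \<beta>) / 2 * \<parallel>\<cdot>\<parallel>\<^sup>2\<close> turns it into an inequality for \<open>\<phi>\<close> with slope \<open>x - P(x)\<close>
    and a quadratic defect of weight \<open>1 - \<beta> < 1\<close>; hence \<open>P(x)\<close> is the proximal point of \<open>\<phi>\<close>
    at \<open>x\<close>.
  \<^item> Dividing it by \<open>\<beta>\<close> gives the slope \<open>x / \<beta> - P(x)\<close>; hence \<open>P(x)\<close> is the proximal point of
    \<open>\<phi>c / \<beta>\<close> at \<open>x / \<beta>\<close>.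
  \<^item> Exchanging point and slope (\<open>fenchel_conjugate_subgradient\<close>) gives
    \<open>P(x) \<in> \<partial>\<phi>c\<^sup>*(q)\<close> for \<open>q = x - \<beta> P(x)\<close>. Multiplied by \<open>\<beta>\<close> this has the slope
    \<open>\<beta> P(x) = x - q\<close>; hence \<open>q\<close> is the proximal point of \<open>\<beta> \<phi>c\<^sup>*\<close> at \<open>x\<close>.

  Eliminating \<open>P\<close> between these three descriptions gives both identities.\<close>

section \<open>Lower semicontinuous convex functions\<close>

lemma lower_semicontinuous_eventually_greater:
  assumes "lower_semicontinuous f" and "c < f x"
  shows "\<forall>\<^sub>F y in nhds x. c < f y"
proof -
  have "c < Liminf (at x) f"
    using assms by (auto simp: lower_semicontinuous_def intro: less_le_trans)
  hence "\<forall>\<^sub>F y in at x. c < f y"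
    by (rule less_LiminfD)
  thus ?thesis
    using assms(2) by (auto simp: eventually_at_filter elim: eventually_mono)
qed

lemma lower_semicontinuous_limit_le:
  fixes f :: "'a::topological_space \<Rightarrow> ereal" and u :: "nat \<Rightarrow> 'a" and a :: "nat \<Rightarrow> real"
  assumes "lower_semicontinuous f" and "u \<longlonglongrightarrow> p" and "a \<longlonglongrightarrow> l"
    and le: "\<And>n. f (u n) \<le> ereal (a n)"
  shows "f p \<le> ereal l"
proof (rule ccontr)
  assume "\<not> f p \<le> ereal l"
  then obtain c where c: "ereal l < ereal c" "ereal c < f p"
    by (metis ereal_dense2 not_le)
  have "\<forall>\<^sub>F n in sequentially. ereal c < f (u n)"
    using lower_semicontinuous_eventually_greater[OF assms(1) c(2)] assms(2)
    by (rule eventually_compose_filterlim)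
  moreover have "\<forall>\<^sub>F n in sequentially. a n < c"
    using order_tendstoD(2)[OF assms(3)] c(1) by simp
  ultimately have "\<forall>\<^sub>F n in sequentially. False"
  proof eventually_elim
    case (elim n)
    hence "ereal c < ereal (a n)"
      using less_le_trans[OF elim(1) le] by simp
    thus False
      using elim(2) by simp
  qed
  thus False by simp
qed

lemma ereal_convex_real:
  assumes "ereal_convex f" and "f x = ereal a" and "f y = ereal b" and "0 < t" and "t < 1"
  shows "f ((1 - t) *\<^sub>R x + t *\<^sub>R y) \<le> ereal ((1 - t) * a + t * b)"
  using assms unfolding ereal_convex_def by (metis plus_ereal.simps(1) times_ereal.simps(1))

text \<open>Lower semicontinuity bounds the function from below on a small ball around a point of its
  domain, and convexity along the segments from the centre turns this into a bound that decreases
  at most linearly. Any positive multiple of the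
  squared norm outweighs such a decrease.\<close>

lemma Gamma0_minorant:
  fixes h :: "'a::{real_inner,complete_space} \<Rightarrow> ereal"
  assumes "h \<in> Gamma0"
  obtains a k where "\<And>y. ereal (a - k * norm y) \<le> h y"
proof -
  have not_minf: "h y \<noteq> -\<infinity>" for y
    using assms by (auto simp: Gamma0_def proper_fun_def)
  have lsc: "lower_semicontinuous h" and conv: "ereal_convex h"
    using assms by (auto simp: Gamma0_def)
  obtain z c where z: "h z = ereal c"
    using assms unfolding Gamma0_def proper_fun_def
    by (smt (verit) mem_Collect_eq ereal_cases less_ereal.simps)
  have "\<forall>\<^sub>F y in nhds z. ereal (c - 1) < h y"
    by (rule lower_semicontinuous_eventually_greater[OF lsc]) (simp add: z)
  then obtain r where r: "0 < r" "\<And>y. dist y z < r \<Longrightarrow> ereal (c - 1) < h y"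
    by (auto simp: eventually_nhds_metric)
  have "ereal (c - 1 - 2 / r * norm z - 2 / r * norm y) \<le> h y" for y
  proof (cases "h y")
    case (real b)
    have "c - 1 - 2 / r * norm (y - z) \<le> b"
    proof (cases "dist y z < r")
      case True
      have "0 \<le> 2 / r * norm (y - z)"
        using r(1) by simp
      moreover have "c - 1 < b"
        using r(2)[OF True] real by simp
      ultimately show ?thesis by linarith
    next
      case False
      hence far: "r \<le> norm (y - z)"
        by (simp add: dist_norm)
      \<comment> \<open>The point of the segment from \<open>z\<close> to \<open>y\<close> at distance \<open>r / 2\<close> from \<open>z\<close>.\<close>
      define t where "t = r / (2 * norm (y - z))"
      define w where "w = (1 - t) *\<^sub>R z + t *\<^sub>R y"
      have pos: "0 < norm (y - z)"
        using far r(1) by linarith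
      have t: "0 < t" "t < 1"
        using far r(1) pos by (simp_all add: t_def divide_simps)
      have "w - z = t *\<^sub>R (y - z)"
        by (simp add: w_def algebra_simps)
      hence "dist w z = r / 2"
        using pos t(1) by (simp add: dist_norm) (simp add: t_def)
      hence "ereal (c - 1) < h w"
        using r by simp
      also have "h w \<le> ereal ((1 - t) * c + t * b)"
        unfolding w_def by (rule ereal_convex_real[OF conv z real t])
      finally have "t * (c - b) < 1"
        by (simp add: algebra_simps)
      hence "c - b < 1 / t"
        using t by (simp add: field_simps)
      also have "1 / t = 2 / r * norm (y - z)"
        using pos r(1) by (simp add: t_def)
      finally show ?thesis by simp
    qed
    moreover have "2 / r * norm (y - z) \<le> 2 / r * (norm y + norm z)"
      using r(1) by (intro mult_left_mono norm_triangle_ineq4) simp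
    ultimately show ?thesis
      using real by (simp add: distrib_left)
  qed (use not_minf in auto)
  thus ?thesis
    by (rule that)
qed

section \<open>Resolvents of subdifferentials\<close>

text \<open>Adding \<open>\<beta> / 2 * \<parallel>y\<parallel>\<^sup>2\<close> makes the function strongly convex, so that every
  minimizing sequence is Cauchy by the parallelogram law; a limit attains the infimum because of
  lower semicontinuity.\<close>

lemma Gamma0_quadratic_minimizer:
  fixes h :: "'a::{real_inner,complete_space} \<Rightarrow> ereal"
  assumes h: "h \<in> Gamma0" and \<beta>: "0 < \<beta>"
  obtains p c where "h p = ereal c"
    and "\<And>y b. h y = ereal b \<Longrightarrow>
      c + \<beta> / 2 * (norm p)\<^sup>2 - x \<bullet> p \<le> b + \<beta> / 2 * (norm y)\<^sup>2 - x \<bullet> y"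
proof -
  have not_minf: "h y \<noteq> -\<infinity>" for y
    using h by (auto simp: Gamma0_def proper_fun_def)
  have lsc: "lower_semicontinuous h" and conv: "ereal_convex h"
    using h by (auto simp: Gamma0_def)
  define D where "D = {y. h y < \<infinity>}"
  define G where "G y = real_of_ereal (h y) + \<beta> / 2 * (norm y)\<^sup>2 - x \<bullet> y" for y
  have D: "h y = ereal (real_of_ereal (h y))" if "y \<in> D" for y
    using that not_minf[of y] by (cases "h y") (auto simp: D_def)
  have in_D: "y \<in> D" "real_of_ereal (h y) \<le> b" if "h y \<le> ereal b" for y b
    using that not_minf[of y] by (cases "h y"; simp add: D_def)+
  have "D \<noteq> {}"
    using h by (auto simp: Gamma0_def proper_fun_def D_def)
  obtain a k where ak: "\<And>y. ereal (a - k * norm y) \<le> h y"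
    using Gamma0_minorant[OF h] by blast
  have "a - (k + norm x)\<^sup>2 / (2 * \<beta>) \<le> G y" if "y \<in> D" for y
  proof -
    have "a - k * norm y \<le> real_of_ereal (h y)"
      using ak[of y] D[OF that] by (metis ereal_less_eq(3))
    moreover have "x \<bullet> y \<le> norm x * norm y"
      by (rule norm_cauchy_schwarz)
    moreover have "0 \<le> (\<beta> * norm y - (k + norm x))\<^sup>2 / (2 * \<beta>)"
      using \<beta> by simp
    hence "0 \<le> \<beta> / 2 * (norm y)\<^sup>2 - (k + norm x) * norm y + (k + norm x)\<^sup>2 / (2 * \<beta>)"
      using \<beta> by (simp add: field_simps power2_eq_square)
    ultimately show ?thesis
      by (simp add: G_def algebra_simps)
  qed
  hence bdd: "bdd_below (G ` D)"
    by (rule bdd_belowI2)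
  define m where "m = Inf (G ` D)"
  have m: "m \<le> G y" if "y \<in> D" for y
    unfolding m_def using bdd that by (intro cInf_lower) auto
  have "\<exists>y\<in>D. G y < m + inverse (real (Suc n))" for n
  proof -
    have "m < m + inverse (real (Suc n))" by simp
    thus ?thesis
      using \<open>D \<noteq> {}\<close> bdd unfolding m_def by (subst (asm) cInf_less_iff) auto
  qed
  then obtain u where u: "\<And>n. u n \<in> D" "\<And>n. G (u n) < m + inverse (real (Suc n))"
    by metis
  have gap: "\<beta> / 4 * (norm (y - z))\<^sup>2 \<le> (G y - m) + (G z - m)" if "y \<in> D" "z \<in> D" for y z
  proof -
    define w where "w = (1 - 1/2) *\<^sub>R y + (1/2) *\<^sub>R z"
    have "h w \<le> ereal ((1 - 1/2) * real_of_ereal (h y) + 1/2 * real_of_ereal (h z))"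
      unfolding w_def by (rule ereal_convex_real[OF conv D D]) (use that in auto)
    note w = in_D[OF this]
    have "\<beta> / 2 * ((norm y)\<^sup>2 / 2 + (norm z)\<^sup>2 / 2 - (norm w)\<^sup>2) = \<beta> / 8 * (norm (y - z))\<^sup>2"
      unfolding w_def power2_norm_eq_inner
      by (simp add: algebra_simps inner_commute)
    moreover have "x \<bullet> w = (x \<bullet> y + x \<bullet> z) / 2"
      by (simp add: w_def inner_add_right field_simps)
    ultimately show ?thesis
      using m[OF w(1)] w(2) by (simp add: G_def algebra_simps)
  qed
  have "Cauchy u"
  proof (rule metric_CauchyI)
    fix e :: real
    assume "0 < e"
    hence "0 < \<beta> * e\<^sup>2 / 8"
      using \<beta> by simp
    then obtain N where N: "inverse (real (Suc N)) < \<beta> * e\<^sup>2 / 8"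
      using reals_Archimedean by blast
    have small: "G (u n) - m < \<beta> * e\<^sup>2 / 8" if "n \<ge> N" for n
    proof -
      have "inverse (real (Suc n)) \<le> inverse (real (Suc N))"
        using that by (intro le_imp_inverse_le) auto
      thus ?thesis
        using u(2)[of n] N by linarith
    qed
    have "dist (u i) (u j) < e" if "i \<ge> N" "j \<ge> N" for i j
    proof -
      have "\<beta> / 4 * (norm (u i - u j))\<^sup>2 < \<beta> / 4 * e\<^sup>2"
        using gap[OF u(1) u(1), of i j] small[OF that(1)] small[OF that(2)] by simp
      hence "(norm (u i - u j))\<^sup>2 < e\<^sup>2"
        using \<beta> by simp
      thus ?thesis
        using \<open>0 < e\<close> by (simp add: dist_norm power_less_imp_less_base)
    qed
    thus "\<exists>M. \<forall>i\<ge>M. \<forall>j\<ge>M. dist (u i) (u j) < e"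
      by blast
  qed
  then obtain p where p: "u \<longlonglongrightarrow> p"
    using Cauchy_convergent convergent_def by blast
  have "h p \<le> ereal (m + 0 - \<beta> / 2 * (norm p)\<^sup>2 + x \<bullet> p)"
  proof (rule lower_semicontinuous_limit_le[OF lsc p])
    show "(\<lambda>n. m + inverse (real (Suc n)) - \<beta> / 2 * (norm (u n))\<^sup>2 + x \<bullet> u n)
        \<longlonglongrightarrow> m + 0 - \<beta> / 2 * (norm p)\<^sup>2 + x \<bullet> p"
      by (intro tendsto_intros p LIMSEQ_inverse_real_of_nat)
    show "h (u n) \<le> ereal (m + inverse (real (Suc n)) - \<beta> / 2 * (norm (u n))\<^sup>2 + x \<bullet> u n)" for n
      using u(2)[of n] by (subst D[OF u(1)]) (simp add: G_def)
  qed
  note p' = in_D[OF this]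
  show ?thesis
  proof (rule that)
    show "h p = ereal (real_of_ereal (h p))"
      by (rule D[OF p'(1)])
    fix y b
    assume "h y = ereal b"
    thus "real_of_ereal (h p) + \<beta> / 2 * (norm p)\<^sup>2 - x \<bullet> p \<le> b + \<beta> / 2 * (norm y)\<^sup>2 - x \<bullet> y"
      using m[of y] p'(2) by (simp add: G_def D_def)
  qed
qed

text \<open>The first-order condition at the minimizer: \<open>p\<close> solves \<open>x \<in> \<beta> p + \<partial>h(p)\<close>.\<close>

lemma Gamma0_resolvent:
  fixes h :: "'a::{real_inner,complete_space} \<Rightarrow> ereal"
  assumes h: "h \<in> Gamma0" and \<beta>: "0 < \<beta>"
  obtains p c where "h p = ereal c"
    and "\<And>y. ereal (c + (x - \<beta> *\<^sub>R p) \<bullet> (y - p)) \<le> h y"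
proof -
  obtain p c where p: "h p = ereal c"
    and min: "\<And>y b. h y = ereal b \<Longrightarrow>
      c + \<beta> / 2 * (norm p)\<^sup>2 - x \<bullet> p \<le> b + \<beta> / 2 * (norm y)\<^sup>2 - x \<bullet> y"
    by (rule Gamma0_quadratic_minimizer[OF h \<beta>, of x]) blast
  have not_minf: "h y \<noteq> -\<infinity>" for y
    using h by (auto simp: Gamma0_def proper_fun_def)
  have conv: "ereal_convex h"
    using h by (auto simp: Gamma0_def)
  have "ereal (c + (x - \<beta> *\<^sub>R p) \<bullet> (y - p)) \<le> h y" for y
  proof (cases "h y")
    case (real b)
    define v where "v = y - p"
    have le: "c + (x - \<beta> *\<^sub>R p) \<bullet> v \<le> b + t * (\<beta> / 2 * (norm v)\<^sup>2)" if t: "0 < t" "t < 1" for t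
    proof -
      have eq: "(1 - t) *\<^sub>R p + t *\<^sub>R y = p + t *\<^sub>R v"
        by (simp add: v_def algebra_simps)
      have le: "h (p + t *\<^sub>R v) \<le> ereal ((1 - t) * c + t * b)"
        using ereal_convex_real[OF conv p real t] by (simp only: eq)
      then obtain d where d: "h (p + t *\<^sub>R v) = ereal d"
        using not_minf by (cases "h (p + t *\<^sub>R v)") auto
      have "c + \<beta> / 2 * (norm p)\<^sup>2 - x \<bullet> p
          \<le> (1 - t) * c + t * b + \<beta> / 2 * (norm (p + t *\<^sub>R v))\<^sup>2 - x \<bullet> (p + t *\<^sub>R v)"
        using min[OF d] le d by simp
      hence "t * (c + (x - \<beta> *\<^sub>R p) \<bullet> v) \<le> t * (b + t * (\<beta> / 2 * (norm v)\<^sup>2))"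
        unfolding power2_norm_eq_inner
        by (simp add: algebra_simps inner_commute)
      thus ?thesis
        using t(1) by simp
    qed
    have "c + (x - \<beta> *\<^sub>R p) \<bullet> v \<le> b + 0 * (\<beta> / 2 * (norm v)\<^sup>2)"
    proof (rule tendsto_lowerbound)
      show "((\<lambda>t. b + t * (\<beta> / 2 * (norm v)\<^sup>2)) \<longlongrightarrow> b + 0 * (\<beta> / 2 * (norm v)\<^sup>2)) (at_right 0)"
        by (intro tendsto_intros)
      show "\<forall>\<^sub>F t in at_right 0. c + (x - \<beta> *\<^sub>R p) \<bullet> v \<le> b + t * (\<beta> / 2 * (norm v)\<^sup>2)"
        using eventually_at_right_real[OF zero_less_one]
        by (rule eventually_mono) (use le in auto)
    qed simp
    thus ?thesis
      using real by (simp add: v_def)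
  qed (use not_minf in auto)
  thus ?thesis
    using that p by blast
qed

section \<open>Certificates for proximal points\<close>

text \<open>The defect \<open>\<gamma> / 2 * \<parallel>y - p\<parallel>\<^sup>2\<close> in the subgradient inequality is admissible for
  \<open>\<gamma> < 1\<close> because the objective contributes \<open>1 / 2 * \<parallel>y - p\<parallel>\<^sup>2\<close>; what remains makes the
  minimizer unique. A positive \<open>\<gamma>\<close> covers weakly convex functions.\<close>

lemma prox_certificate:
  fixes f :: "'a::real_inner \<Rightarrow> ereal"
  assumes p: "f p = ereal c" and \<gamma>: "\<gamma> < 1"
    and sub: "\<And>y. ereal (c + (x - p) \<bullet> (y - p) - \<gamma> / 2 * (norm (y - p))\<^sup>2) \<le> f y"
  shows "is_arg_min (prox_objective f x) (\<lambda>_. True) y \<longleftrightarrow> y = p"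
proof -
  have less: "prox_objective f x p < prox_objective f x y" if "y \<noteq> p" for y
  proof (cases "f y")
    case (real b)
    have "(norm (x - y))\<^sup>2 - (norm (x - p))\<^sup>2 = (norm (y - p))\<^sup>2 - 2 * ((x - p) \<bullet> (y - p))"
      unfolding power2_norm_eq_inner by (simp add: algebra_simps inner_commute)
    moreover have "c + (x - p) \<bullet> (y - p) - \<gamma> / 2 * (norm (y - p))\<^sup>2 \<le> b"
      using sub[of y] real by simp
    moreover have "\<gamma> * (norm (y - p))\<^sup>2 < 1 * (norm (y - p))\<^sup>2"
      using \<gamma> that by (intro mult_strict_right_mono) auto
    ultimately show ?thesis
      using p real by (simp add: prox_objective_def)
  qed (use p sub[of y] in \<open>auto simp: prox_objective_def\<close>)
  show ?thesis
  proof
    assume "is_arg_min (prox_objective f x) (\<lambda>_. True) y"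
    thus "y = p"
      using less by (auto simp: is_arg_min_def)
  next
    assume "y = p"
    thus "is_arg_min (prox_objective f x) (\<lambda>_. True) y"
      using less by (auto simp: is_arg_min_def) (metis less order_less_asym order_less_irrefl)
  qed
qed

lemma s_Prox_eqI:
  assumes "\<And>y. is_arg_min (prox_objective f x) (\<lambda>_. True) y \<longleftrightarrow> y = p"
  shows "s_Prox f x = p"
  using assms by (simp add: s_Prox_def arg_min_def)

lemma has_s_ProxI:
  assumes "proper_fun f"
    and "\<And>x y. is_arg_min (prox_objective f x) (\<lambda>_. True) y \<longleftrightarrow> y = P x"
  shows "has_s_Prox f"
  using assms by (simp add: has_s_Prox_def)

text \<open>If \<open>q\<close> is a subgradient of \<open>h\<close> at \<open>p\<close>, the supremum that defines the conjugate at \<open>q\<close> is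
  attained at \<open>p\<close>, while at every other \<open>z\<close> the same \<open>p\<close> still gives a lower bound. Comparing the
  two shows that \<open>p\<close> is a subgradient of the conjugate at \<open>q\<close>.\<close>

lemma fenchel_conjugate_subgradient:
  fixes h :: "'a::real_inner \<Rightarrow> ereal"
  assumes p: "h p = ereal c" and sub: "\<And>y. ereal (c + q \<bullet> (y - p)) \<le> h y"
  shows "fenchel_conjugate h q = ereal (q \<bullet> p - c)"
    and "ereal (q \<bullet> p - c + (z - q) \<bullet> p) \<le> fenchel_conjugate h z"
proof -
  have lower: "ereal (z \<bullet> p - c) \<le> fenchel_conjugate h z" for z
    unfolding fenchel_conjugate_def using p by (intro SUP_upper2[of p]) auto
  have "ereal (q \<bullet> y) - h y \<le> ereal (q \<bullet> p - c)" for y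
    using sub[of y] by (cases "h y") (auto simp: inner_diff_right)
  hence "fenchel_conjugate h q \<le> ereal (q \<bullet> p - c)"
    unfolding fenchel_conjugate_def by (intro SUP_least) auto
  thus "fenchel_conjugate h q = ereal (q \<bullet> p - c)"
    using lower[of q] by (intro antisym) auto
  show "ereal (q \<bullet> p - c + (z - q) \<bullet> p) \<le> fenchel_conjugate h z"
    using lower[of z] by (simp add: inner_diff_left)
qed

section \<open>The proximity operators\<close>

theorem proposition2:
  fixes \<beta> :: real
    and \<phi> \<phi>c :: "'a::{real_inner,complete_space} \<Rightarrow> ereal"
  assumes "0 < \<beta>" and "\<beta> < 1"
    and "proper_fun \<phi>"
    and "\<phi>c = (\<lambda>x. \<phi> x + ereal ((1 - \<beta>) / 2 * (norm x)\<^sup>2))"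
    and "\<phi>c \<in> Gamma0"
  shows "has_s_Prox \<phi> \<and> has_s_Prox (\<lambda>x. \<phi>c x / ereal \<beta>)
      \<and> has_s_Prox (\<lambda>x. ereal \<beta> * fenchel_conjugate \<phi>c x)
      \<and> s_Prox \<phi> = s_Prox (\<lambda>x. \<phi>c x / ereal \<beta>) \<circ> (\<lambda>x. inverse \<beta> *\<^sub>R x)
      \<and> id = (\<lambda>x. \<beta> *\<^sub>R s_Prox \<phi> x
                + s_Prox (\<lambda>x. ereal \<beta> * fenchel_conjugate \<phi>c x) x)"
proof -
  let ?f = "\<lambda>x. \<phi>c x / ereal \<beta>"
  let ?g = "\<lambda>x. ereal \<beta> * fenchel_conjugate \<phi>c x"
  have \<phi>: "\<phi>c y = \<phi> y + ereal ((1 - \<beta>) / 2 * (norm y)\<^sup>2)" for y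
    using assms(4) by simp
  have not_minf: "\<phi>c y \<noteq> -\<infinity>" for y
    using assms(5) by (auto simp: Gamma0_def proper_fun_def)
  have "\<exists>p c. \<phi>c p = ereal c \<and> (\<forall>y. ereal (c + (x - \<beta> *\<^sub>R p) \<bullet> (y - p)) \<le> \<phi>c y)" for x
    by (rule Gamma0_resolvent[OF assms(5,1), of x]) blast
  then obtain P c where P: "\<And>x. \<phi>c (P x) = ereal (c x)"
    and sub: "\<And>x y. ereal (c x + (x - \<beta> *\<^sub>R P x) \<bullet> (y - P x)) \<le> \<phi>c y"
    by metis
  have \<phi>_prox: "is_arg_min (prox_objective \<phi> x) (\<lambda>_. True) y \<longleftrightarrow> y = P x" for x y
  proof (rule prox_certificate)
    let ?p = "P x"
    show "\<phi> ?p = ereal (c x - (1 - \<beta>) / 2 * (norm ?p)\<^sup>2)"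
      using P[of x] \<phi>[of ?p] by (cases "\<phi> ?p") auto
    show "1 - \<beta> < 1"
      using assms(1) by simp
    fix y
    have "(norm y)\<^sup>2 = (norm ?p)\<^sup>2 + 2 * (?p \<bullet> (y - ?p)) + (norm (y - ?p))\<^sup>2"
      unfolding power2_norm_eq_inner by (simp add: algebra_simps inner_commute)
    thus "ereal (c x - (1 - \<beta>) / 2 * (norm ?p)\<^sup>2 + (x - ?p) \<bullet> (y - ?p)
        - (1 - \<beta>) / 2 * (norm (y - ?p))\<^sup>2) \<le> \<phi> y"
      using sub[of x y] \<phi>[of y] by (cases "\<phi> y") (auto simp: inner_diff_left field_simps)
  qed
  have f_prox: "is_arg_min (prox_objective ?f x) (\<lambda>_. True) y \<longleftrightarrow> y = P (\<beta> *\<^sub>R x)" for x y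
  proof (rule prox_certificate)
    let ?p = "P (\<beta> *\<^sub>R x)"
    show "\<phi>c ?p / ereal \<beta> = ereal (c (\<beta> *\<^sub>R x) / \<beta>)"
      using assms(1) by (simp add: P)
    show "(0::real) < 1"
      by simp
    fix y
    have "(\<beta> *\<^sub>R x - \<beta> *\<^sub>R ?p) \<bullet> (y - ?p) = \<beta> * ((x - ?p) \<bullet> (y - ?p))"
      by (simp add: scaleR_diff_right[symmetric])
    hence le: "ereal (c (\<beta> *\<^sub>R x) + \<beta> * ((x - ?p) \<bullet> (y - ?p))) \<le> \<phi>c y"
      using sub[of "\<beta> *\<^sub>R x" y] by simp
    have "c (\<beta> *\<^sub>R x) / \<beta> + (x - ?p) \<bullet> (y - ?p) = (c (\<beta> *\<^sub>R x) + \<beta> * ((x - ?p) \<bullet> (y - ?p))) / \<beta>"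
      using assms(1) by (simp add: add_divide_distrib)
    thus "ereal (c (\<beta> *\<^sub>R x) / \<beta> + (x - ?p) \<bullet> (y - ?p) - 0 / 2 * (norm (y - ?p))\<^sup>2) \<le> \<phi>c y / ereal \<beta>"
      using le assms(1) by (cases "\<phi>c y") (auto simp: divide_right_mono)
  qed
  \<comment> \<open>The slope \<open>x - \<beta> P(x)\<close> is a subgradient of \<open>\<phi>c\<close> at \<open>P(x)\<close>, hence \<open>P(x)\<close> is one of the
    conjugate there, and \<open>\<beta> P(x)\<close> is exactly the displacement that the certificate requires.\<close>
  have conj: "fenchel_conjugate \<phi>c (x - \<beta> *\<^sub>R P x) = ereal ((x - \<beta> *\<^sub>R P x) \<bullet> P x - c x)"
    "ereal ((x - \<beta> *\<^sub>R P x) \<bullet> P x - c x + (z - (x - \<beta> *\<^sub>R P x)) \<bullet> P x) \<le> fenchel_conjugate \<phi>c z"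
    for x z
    using fenchel_conjugate_subgradient[of \<phi>c "P x" "c x" "x - \<beta> *\<^sub>R P x"] P sub by auto
  have g_prox: "is_arg_min (prox_objective ?g x) (\<lambda>_. True) y \<longleftrightarrow> y = x - \<beta> *\<^sub>R P x" for x y
  proof (rule prox_certificate)
    let ?q = "x - \<beta> *\<^sub>R P x"
    show "ereal \<beta> * fenchel_conjugate \<phi>c ?q = ereal (\<beta> * (?q \<bullet> P x - c x))"
      by (simp add: conj(1))
    show "(0::real) < 1"
      by simp
    fix z
    have "ereal (\<beta> * (?q \<bullet> P x - c x) + (x - ?q) \<bullet> (z - ?q) - 0 / 2 * (norm (z - ?q))\<^sup>2)
        = ereal \<beta> * ereal (?q \<bullet> P x - c x + (z - ?q) \<bullet> P x)"
      by (simp add: algebra_simps inner_commute)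
    also have "\<dots> \<le> ereal \<beta> * fenchel_conjugate \<phi>c z"
      using assms(1) by (intro ereal_mult_left_mono conj(2)) auto
    finally show "ereal (\<beta> * (?q \<bullet> P x - c x) + (x - ?q) \<bullet> (z - ?q) - 0 / 2 * (norm (z - ?q))\<^sup>2)
        \<le> ereal \<beta> * fenchel_conjugate \<phi>c z" .
  qed
  have f_proper: "proper_fun ?f"
    unfolding proper_fun_def
  proof (intro conjI allI)
    show "\<phi>c y / ereal \<beta> \<noteq> -\<infinity>" for y
      using not_minf[of y] assms(1) by (cases "\<phi>c y") auto
    show "\<exists>y. \<phi>c y / ereal \<beta> < \<infinity>"
      using P[of 0] assms(1) by (intro exI[of _ "P 0"]) simp
  qed
  have g_proper: "proper_fun ?g"
    unfolding proper_fun_def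
  proof (intro conjI allI)
    show "ereal \<beta> * fenchel_conjugate \<phi>c y \<noteq> -\<infinity>" for y
      using conj(2)[of 0 y] assms(1) by (cases "fenchel_conjugate \<phi>c y") auto
    show "\<exists>y. ereal \<beta> * fenchel_conjugate \<phi>c y < \<infinity>"
      using conj(1)[of 0] by (intro exI[of _ "0 - \<beta> *\<^sub>R P 0"]) (simp only: times_ereal.simps less_ereal.simps)
  qed
  have \<phi>_eq: "s_Prox \<phi> = P"
    using s_Prox_eqI[OF \<phi>_prox] by blast
  have f_eq: "s_Prox ?f = (\<lambda>x. P (\<beta> *\<^sub>R x))"
    using s_Prox_eqI[OF f_prox] by blast
  have g_eq: "s_Prox ?g x = x - \<beta> *\<^sub>R P x" for x
    by (rule s_Prox_eqI[OF g_prox])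
  show ?thesis
  proof (intro conjI)
    show "has_s_Prox \<phi>"
      by (rule has_s_ProxI[OF assms(3) \<phi>_prox])
    show "has_s_Prox ?f"
      by (rule has_s_ProxI[OF f_proper f_prox])
    show "has_s_Prox ?g"
      by (rule has_s_ProxI[OF g_proper g_prox])
    show "s_Prox \<phi> = s_Prox ?f \<circ> (\<lambda>x. inverse \<beta> *\<^sub>R x)"
      using assms(1) by (simp add: \<phi>_eq f_eq comp_def)
    show "id = (\<lambda>x. \<beta> *\<^sub>R s_Prox \<phi> x + s_Prox ?g x)"
      by (simp add: \<phi>_eq g_eq id_def)
  qed
qed

end
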